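(* Let $S\subset(0,\infty)$ be a closed semigroup with $1\in S$. Then: 1. Either $S=(0,\infty)$ or $S\subset[\lambda,\infty)$ for some $\lambda>0$. 2. If the interior of $S$ is non-empty, then $S\supset[\lambda,\infty)$ for some $\lambda$ with $0<\lambda<\infty$.
   Context: "Semigroup" means closed under addition: $s,t\in S$ implies $s+t\in S$. "Closed" means closed relative to the space $(0,\infty)$ with its usual topology. *)

theory Defs
  imports "HOL-Analysis.Analysis"
begin

definition add_semigroup :: "real set \<Rightarrow> bool" where
  "add_semigroup S \<longleftrightarrow> (\<forall>s\<in>S. \<forall>t\<in>S. s + t \<in> S)"

end

theory Submission
  imports Defs
begin

text \<open>
  Both parts rest on the fact that a semigroup contains every positive multiple of each of its
  elements. If \<open>S\<close> has arbitrarily small elements, then each \<open>x > 0\<close> lies within \<open>s\<close> of the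
  multiple \<open>\<lfloor>x / s\<rfloor> s\<close> of any small \<open>s \<in> S\<close>; hence \<open>S\<close> is dense in the half-line and, being
  relatively closed, equal to it. If \<open>S\<close> contains an interval \<open>[a, b]\<close> with \<open>a < b\<close>, then it
  contains \<open>[n a, n b]\<close> for every \<open>n \<ge> 1\<close>; once this has length at least \<open>1\<close>, its translates by
  the natural numbers, which stay in \<open>S\<close> since \<open>1 \<in> S\<close>, cover \<open>[n a, \<infinity>)\<close>.
\<close>

lemma add_semigroup_multiple:
  assumes "add_semigroup S" "s \<in> S" "n > 0"
  shows "real n * s \<in> S"
  using assms(3)
proof (induction n rule: nat_induct_non_zero)
  case 1
  show ?case using assms(2) by simp
next
  case (Suc n)
  have "real n * s + s \<in> S"
    using assms Suc.IH by (auto simp: add_semigroup_def)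
  then show ?case by (simp add: algebra_simps)
qed

lemma pos_in_closure_add_semigroup:
  assumes pos: "S \<subseteq> {0<..}" and sg: "add_semigroup S"
    and small: "\<And>e. e > 0 \<Longrightarrow> \<exists>s\<in>S. s < e"
    and x: "x > 0"
  shows "x \<in> closure S"
  unfolding closure_approachable
proof (intro allI impI)
  fix e :: real
  assume "e > 0"
  then obtain s where s: "s \<in> S" "s < min e x"
    using small[of "min e x"] x by auto
  have s0: "s > 0" using s pos by auto
  define n where "n = nat \<lfloor>x / s\<rfloor>"
  have "x / s \<ge> 1" using s s0 by simp
  then have n1: "n > 0" and n2: "real n \<le> x / s" and n3: "x / s < real n + 1"
    unfolding n_def by linarith+
  have "real n * s \<le> x" "x < real n * s + s"
    using n2 n3 s0 by (simp_all add: field_simps)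
  then have "dist (real n * s) x < e"
    using s by (simp add: dist_real_def)
  then show "\<exists>y\<in>S. dist y x < e"
    using add_semigroup_multiple[OF sg s(1) n1] by blast
qed

lemma add_semigroup_contains_ray:
  fixes a b :: real
  assumes sg: "add_semigroup S" and one: "1 \<in> S"
    and ab: "a < b" "{a..b} \<subseteq> S"
  shows "\<exists>n>0. {real n * a..} \<subseteq> S"
proof -
  obtain n :: nat where n: "1 / (b - a) < real n"
    using reals_Archimedean2 by blast
  have n0: "n > 0"
  proof (rule ccontr)
    assume "\<not> n > 0"
    with n have "1 / (b - a) < 0" by simp
    with ab(1) show False by simp
  qed
  have len: "real n * a + 1 \<le> real n * b"
    using n ab(1) by (simp add: field_simps)
  have unit: "y \<in> S" if y: "real n * a \<le> y" "y \<le> real n * a + 1" for y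
  proof -
    have "y / real n \<in> {a..b}"
      using y len n0 by (simp add: field_simps)
    then have "real n * (y / real n) \<in> S"
      using ab(2) add_semigroup_multiple[OF sg _ n0] by blast
    then show ?thesis using n0 by simp
  qed
  have "x \<in> S" if x: "real n * a \<le> x" for x
  proof -
    define k where "k = nat \<lfloor>x - real n * a\<rfloor>"
    have k: "real k \<le> x - real n * a" "x - real n * a < real k + 1"
      unfolding k_def using x by linarith+
    have y: "x - real k \<in> S"
      using k by (intro unit) linarith+
    show ?thesis
    proof (cases "k = 0")
      case True
      then show ?thesis using y by simp
    next
      case False
      then have "real k * 1 \<in> S"
        by (intro add_semigroup_multiple[OF sg one]) simp
      then have "(x - real k) + real k * 1 \<in> S"
        using y sg unfolding add_semigroup_def by blast
      then show ?thesis by simp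
    qed
  qed
  then show ?thesis using n0 by auto
qed

theorem proposition2p2:
  fixes S :: "real set"
  assumes "S \<subseteq> {0<..}"
    and "closedin (top_of_set {0<..}) S"
    and "add_semigroup S"
    and "1 \<in> S"
  shows "(S = {0<..} \<or> (\<exists>l>0. S \<subseteq> {l..})) \<and>
         (interior S \<noteq> {} \<longrightarrow> (\<exists>l>0. {l..} \<subseteq> S))"
proof (intro conjI impI)
  show "S = {0<..} \<or> (\<exists>l>0. S \<subseteq> {l..})"
  proof (cases "\<exists>l>0. S \<subseteq> {l..}")
    case False
    then have small: "\<exists>s\<in>S. s < e" if "e > 0" for e
      using that by (auto simp: subset_eq not_le)
    obtain T where T: "closed T" "S = {0<..} \<inter> T"
      using assms(2) by (auto simp: closedin_closed)
    then have "closure S \<subseteq> T"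
      by (intro closure_minimal) auto
    then have "{0<..} \<subseteq> S"
      using pos_in_closure_add_semigroup[OF assms(1,3) small] T(2) by auto
    then show ?thesis using assms(1) by auto
  qed simp
next
  assume "interior S \<noteq> {}"
  then obtain c e where e: "e > 0" "cball c e \<subseteq> S"
    by (auto simp: mem_interior_cball)
  have ab: "c - e < c + e" "{c - e..c + e} \<subseteq> S"
    using e by (simp_all add: cball_eq_atLeastAtMost)
  then obtain n where n: "n > 0" "{real n * (c - e)..} \<subseteq> S"
    using add_semigroup_contains_ray[OF assms(3,4)] by blast
  have "real n * (c - e) \<in> S" using n(2) by auto
  then have "real n * (c - e) > 0" using assms(1) by auto
  then show "\<exists>l>0. {l..} \<subseteq> S" using n(2) by blast
qed

end
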